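(* Let $\kappa$ be an infinite cardinal, and let $\mathcal{F}$ and $\mathcal{G}$ be compact and hereditary families on $\kappa$ with the additional property that $[\kappa]^1 \subseteq \overline{\mathcal{F}^{MAX}} \cap \overline{\mathcal{G}^{MAX}}$. If $T: X_{\mathcal{F}} \to X_{\mathcal{G}}$ is an isometry, then there exist a permutation $\pi$ of $\kappa$ and a family of scalars $(\theta_\alpha)_{\alpha\in\kappa}$ with $|\theta_\alpha| = 1$ such that $T e_\alpha = \theta_\alpha e_{\pi(\alpha)}$ for all $\alpha \in \kappa$.
   Context: A family on $\kappa$ is a set $\mathcal{F}$ of finite subsets of $\kappa$ which contains $[\kappa]^{\leq 1}$, i.e. the empty set and all singletons. Here $[\kappa]^n$ is the collection of subsets of $\kappa$ of size $n$. $\mathcal{F}$ is hereditary if it is closed under subsets. Identifying sets with characteristic functions, $\mathcal{F}$ is a subspace of $2^\kappa$ (product topology); $\mathcal{F}$ is compact if it is closed in $2^\kappa$, and the closure $\overline{\,\cdot\,}$ of a family is taken in this topology. $\mathcal{F}^{MAX}$ is the set of elements of $\mathcal{F}$ that are maximal with respect to inclusion. The scalar field $\mathbb{K}$ is $\mathbb{R}$ or $\mathbb{C}$. For a hereditary family $\mathcal{F}$ on $\kappa$, the combinatorial Banach space $X_{\mathcal{F}}$ is the completion of $c_{00}(\kappa)$ (finitely supported functions $\kappa\to\mathbb{K}$) with respect to the norm $\|x\| = \sup\{\sum_{\alpha\in s}|x(\alpha)| : s\in\mathcal{F}\}$. $(e_\alpha)_{\alpha\in\kappa}$ denotes the unit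 vectors, which form the canonical basis. An isometry between Banach spaces is a linear bijective norm-preserving operator. A permutation of $\kappa$ is a bijection $\kappa\to\kappa$. *)

theory Defs
  imports "HOL-Analysis.Analysis"
begin

section \<open>Families of finite sets\<close>

text \<open>An infinite cardinal is represented by an arbitrary infinite type \<open>'k\<close>.\<close>

definition family_on :: "'k set set \<Rightarrow> bool" where
  "family_on F \<longleftrightarrow> (\<forall>s\<in>F. finite s) \<and> {} \<in> F \<and> (\<forall>a. {a} \<in> F)"

definition hereditary :: "'k set set \<Rightarrow> bool" where
  "hereditary F \<longleftrightarrow> (\<forall>s\<in>F. \<forall>t. t \<subseteq> s \<longrightarrow> t \<in> F)"

definition maximal_sets :: "'k set set \<Rightarrow> 'k set set" where
  "maximal_sets F = {s \<in> F. \<forall>t\<in>F. s \<subseteq> t \<longrightarrow> t = s}"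

text \<open>Topological notions for families refer to characteristic functions in \<open>'k \<Rightarrow> bool\<close>,
  whose topology is the product of the discrete topologies on \<open>bool\<close>.\<close>

definition chi :: "'k set \<Rightarrow> 'k \<Rightarrow> bool" where
  "chi s = (\<lambda>a. a \<in> s)"

definition compact_family :: "'k set set \<Rightarrow> bool" where
  "compact_family F \<longleftrightarrow> closed (chi ` F)"

definition family_closure :: "'k set set \<Rightarrow> 'k set set" where
  "family_closure F = {s. chi s \<in> closure (chi ` F)}"


section \<open>Combinatorial Banach spaces\<close>

definition c00 :: "('k \<Rightarrow> 'a::real_normed_field) set" where
  "c00 = {x. finite {a. x a \<noteq> 0}}"

definition unit_vec :: "'k \<Rightarrow> 'k \<Rightarrow> 'a::real_normed_field" where
  "unit_vec a = (\<lambda>b. if b = a then 1 else 0)"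

definition comb_bounded :: "'k set set \<Rightarrow> ('k \<Rightarrow> 'a::real_normed_field) set" where
  "comb_bounded F = {x. bdd_above ((\<lambda>s. \<Sum>a\<in>s. norm (x a)) ` F)}"

text \<open>Meaningful on \<^term>\<open>comb_bounded F\<close>, which contains \<^term>\<open>c00\<close>.\<close>

definition comb_norm :: "'k set set \<Rightarrow> ('k \<Rightarrow> 'a::real_normed_field) \<Rightarrow> real" where
  "comb_norm F x = (SUP s\<in>F. \<Sum>a\<in>s. norm (x a))"

text \<open>The completion of \<^term>\<open>c00\<close> is realised as its closure in the space of all functions of
  finite norm. The lemmas \<open>comb_space_complete\<close> and \<open>c00_dense_comb_space\<close> below show that
  this is a complete space in which \<^term>\<open>c00\<close> is dense.\<close>

definition comb_space :: "'k set set \<Rightarrow> ('k \<Rightarrow> 'a::real_normed_field) set" where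
  "comb_space F =
    {x \<in> comb_bounded F. \<forall>\<epsilon>>0. \<exists>y\<in>c00. comb_norm F (\<lambda>a. x a - y a) < \<epsilon>}"

text \<open>Since HOL functions are total, \<open>T\<close> is only constrained on \<^term>\<open>comb_space F\<close>.\<close>

definition comb_isometry ::
  "'k set set \<Rightarrow> 'k set set \<Rightarrow> (('k \<Rightarrow> 'a::real_normed_field) \<Rightarrow> 'k \<Rightarrow> 'a) \<Rightarrow> bool" where
  "comb_isometry F G T \<longleftrightarrow>
     bij_betw T (comb_space F) (comb_space G) \<and>
     (\<forall>x\<in>comb_space F. \<forall>y\<in>comb_space F. T (\<lambda>a. x a + y a) = (\<lambda>a. T x a + T y a)) \<and>
     (\<forall>c. \<forall>x\<in>comb_space F. T (\<lambda>a. c * x a) = (\<lambda>a. c * T x a)) \<and>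
     (\<forall>x\<in>comb_space F. comb_norm G (T x) = comb_norm F x)"


section \<open>The space is a completion\<close>

lemma sum_le_comb_norm:
  "x \<in> comb_bounded F \<Longrightarrow> s \<in> F \<Longrightarrow> (\<Sum>a\<in>s. norm (x a)) \<le> comb_norm F x"
  unfolding comb_bounded_def comb_norm_def by (auto intro: cSUP_upper)

lemma comb_norm_le:
  assumes "family_on F" "\<And>s. s \<in> F \<Longrightarrow> (\<Sum>a\<in>s. norm (x a)) \<le> c"
  shows "comb_norm F x \<le> c"
  unfolding comb_norm_def using assms by (intro cSUP_least) (auto simp: family_on_def)

lemma comb_boundedI:
  "(\<And>s. s \<in> F \<Longrightarrow> (\<Sum>a\<in>s. norm (x a)) \<le> c) \<Longrightarrow> x \<in> comb_bounded F"
  unfolding comb_bounded_def by (simp add: bdd_aboveI2[where M = c])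

lemma norm_le_comb_norm:
  assumes "family_on F" "x \<in> comb_bounded F"
  shows "norm (x a) \<le> comb_norm F x"
  using sum_le_comb_norm[OF assms(2), of "{a}"] assms(1) by (auto simp: family_on_def)

lemma comb_norm_nonneg:
  assumes "family_on F" "x \<in> comb_bounded F"
  shows "0 \<le> comb_norm F x"
  using norm_le_comb_norm[OF assms] norm_ge_zero order_trans by blast

lemma comb_norm_eq_0_iff:
  assumes "family_on F" "x \<in> comb_bounded F"
  shows "comb_norm F x = 0 \<longleftrightarrow> x = (\<lambda>_. 0)"
proof
  assume "comb_norm F x = 0"
  then show "x = (\<lambda>_. 0)"
    using norm_le_comb_norm[OF assms] by (auto simp: fun_eq_iff)
next
  assume x: "x = (\<lambda>_. 0)"
  have "comb_norm F x \<le> 0"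
    by (rule comb_norm_le[OF assms(1)]) (simp add: x)
  then show "comb_norm F x = 0"
    using comb_norm_nonneg[OF assms] by simp
qed

lemma comb_sum_add:
  assumes "x \<in> comb_bounded F" "y \<in> comb_bounded F" "s \<in> F"
  shows "(\<Sum>a\<in>s. norm (x a + y a)) \<le> comb_norm F x + comb_norm F y"
proof -
  have "(\<Sum>a\<in>s. norm (x a + y a)) \<le> (\<Sum>a\<in>s. norm (x a)) + (\<Sum>a\<in>s. norm (y a))"
    unfolding sum.distrib[symmetric] by (intro sum_mono norm_triangle_ineq)
  then show ?thesis
    using sum_le_comb_norm[OF assms(1,3)] sum_le_comb_norm[OF assms(2,3)] by linarith
qed

lemma comb_bounded_add:
  "x \<in> comb_bounded F \<Longrightarrow> y \<in> comb_bounded F \<Longrightarrow> (\<lambda>a. x a + y a) \<in> comb_bounded F"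
  by (rule comb_boundedI, rule comb_sum_add)

lemma comb_norm_triangle:
  assumes "family_on F" "x \<in> comb_bounded F" "y \<in> comb_bounded F"
  shows "comb_norm F (\<lambda>a. x a + y a) \<le> comb_norm F x + comb_norm F y"
  by (rule comb_norm_le[OF assms(1)], rule comb_sum_add[OF assms(2,3)])

lemma comb_bounded_scale:
  assumes "x \<in> comb_bounded F"
  shows "(\<lambda>a. c * x a) \<in> comb_bounded F"
  by (rule comb_boundedI[where c = "norm c * comb_norm F x"])
    (simp add: norm_mult sum_distrib_left[symmetric] mult_left_mono sum_le_comb_norm[OF assms])

lemma comb_norm_scale:
  assumes F: "family_on F" and x: "x \<in> comb_bounded F"
  shows "comb_norm F (\<lambda>a. c * x a) = norm c * comb_norm F x"
proof -
  have le: "comb_norm F (\<lambda>a. d * y a) \<le> norm d * comb_norm F y"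
    if "y \<in> comb_bounded F" for d :: 'b and y :: "'a \<Rightarrow> 'b"
    by (rule comb_norm_le[OF F])
      (simp add: norm_mult sum_distrib_left[symmetric] mult_left_mono sum_le_comb_norm[OF that])
  show ?thesis
  proof (cases "c = 0")
    case True
    then show ?thesis
      using F by (simp add: comb_norm_def family_on_def cSUP_const)
        (metis cSUP_const empty_iff)
  next
    case False
    have "comb_norm F x \<le> norm (inverse c) * comb_norm F (\<lambda>a. c * x a)"
      using le[OF comb_bounded_scale[OF x], of "inverse c" c] False
      by (simp add: mult.assoc[symmetric])
    then have "norm c * comb_norm F x \<le> comb_norm F (\<lambda>a. c * x a)"
      using False unfolding norm_inverse by (simp add: field_simps)
    with le[OF x, of c] show ?thesis by linarith
  qed
qed

lemma comb_bounded_diff: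
  assumes "x \<in> comb_bounded F" "y \<in> comb_bounded F"
  shows "(\<lambda>a. x a - y a) \<in> comb_bounded F"
  using comb_bounded_add[OF assms(1) comb_bounded_scale[OF assms(2), of "-1"]] by simp

lemma comb_norm_minus_commute: "comb_norm F (\<lambda>a. x a - y a) = comb_norm F (\<lambda>a. y a - x a)"
  unfolding comb_norm_def by (simp add: norm_minus_commute)

lemma comb_dist_triangle:
  assumes "family_on F" "x \<in> comb_bounded F" "y \<in> comb_bounded F" "z \<in> comb_bounded F"
  shows "comb_norm F (\<lambda>a. x a - z a) \<le> comb_norm F (\<lambda>a. x a - y a) + comb_norm F (\<lambda>a. y a - z a)"
  using comb_norm_triangle[OF assms(1) comb_bounded_diff[OF assms(2,3)] comb_bounded_diff[OF assms(3,4)]]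
  by simp

lemma c00_subset_comb_bounded:
  assumes "family_on F"
  shows "c00 \<subseteq> comb_bounded F"
proof
  fix x :: "'a \<Rightarrow> 'b" assume "x \<in> c00"
  then have fin: "finite {a. x a \<noteq> 0}" by (simp add: c00_def)
  show "x \<in> comb_bounded F"
  proof (rule comb_boundedI)
    fix s assume "s \<in> F"
    then have s: "finite s" using assms by (simp add: family_on_def)
    have "(\<Sum>a\<in>s. norm (x a)) = (\<Sum>a\<in>s \<inter> {a. x a \<noteq> 0}. norm (x a))"
      by (rule sum.mono_neutral_right) (use s in auto)
    also have "\<dots> \<le> (\<Sum>a | x a \<noteq> 0. norm (x a))"
      by (rule sum_mono2) (use fin in auto)
    finally show "(\<Sum>a\<in>s. norm (x a)) \<le> (\<Sum>a | x a \<noteq> 0. norm (x a))" .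
  qed
qed

lemma c00_subset_comb_space:
  assumes "family_on F"
  shows "c00 \<subseteq> comb_space F"
proof
  fix x :: "'a \<Rightarrow> 'b" assume x: "x \<in> c00"
  have "comb_norm F (\<lambda>a. x a - x a) \<le> 0"
    by (rule comb_norm_le[OF assms]) simp
  then show "x \<in> comb_space F"
    using x c00_subset_comb_bounded[OF assms] unfolding comb_space_def
    by (auto intro!: bexI[of _ x])
qed

lemma unit_vec_in_comb_space:
  assumes "family_on F"
  shows "unit_vec a \<in> comb_space F"
proof -
  have "unit_vec a \<in> c00" by (simp add: c00_def unit_vec_def)
  then show ?thesis using c00_subset_comb_space[OF assms] by blast
qed

lemma comb_space_add:
  assumes F: "family_on F" and x: "x \<in> comb_space F" and y: "y \<in> comb_space F"
  shows "(\<lambda>a. x a + y a) \<in> comb_space F"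
proof -
  have b: "x \<in> comb_bounded F" "y \<in> comb_bounded F"
    using x y by (auto simp: comb_space_def)
  have "\<exists>z\<in>c00. comb_norm F (\<lambda>a. (x a + y a) - z a) < \<epsilon>" if e: "\<epsilon> > 0" for \<epsilon>
  proof -
    have e2: "\<epsilon>/2 > 0" using e by simp
    obtain u where u: "u \<in> c00" "comb_norm F (\<lambda>a. x a - u a) < \<epsilon>/2"
      using x e2 unfolding comb_space_def by blast
    obtain v where v: "v \<in> c00" "comb_norm F (\<lambda>a. y a - v a) < \<epsilon>/2"
      using y e2 unfolding comb_space_def by blast
    note uv = u(1) v(1) u(2) v(2)
    have "{a. u a + v a \<noteq> 0} \<subseteq> {a. u a \<noteq> 0} \<union> {a. v a \<noteq> 0}" by auto
    then have "(\<lambda>a. u a + v a) \<in> c00"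
      using uv(1,2) by (auto simp: c00_def intro: finite_subset)
    moreover have "comb_norm F (\<lambda>a. (x a - u a) + (y a - v a)) < \<epsilon>"
      using comb_norm_triangle[OF F comb_bounded_diff[of x F u] comb_bounded_diff[of y F v]]
        uv b c00_subset_comb_bounded[OF F] by (fastforce dest: subsetD)
    ultimately show ?thesis
      by (intro bexI[of _ "\<lambda>a. u a + v a"]) (simp_all add: algebra_simps)
  qed
  then show ?thesis using comb_bounded_add[OF b] by (simp add: comb_space_def)
qed

lemma comb_space_scale:
  assumes F: "family_on F" and x: "x \<in> comb_space F"
  shows "(\<lambda>a. c * x a) \<in> comb_space F"
proof (cases "c = 0")
  case True
  then show ?thesis using c00_subset_comb_space[OF F] by (auto simp: c00_def)
next
  case False
  have b: "x \<in> comb_bounded F"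
    using x by (auto simp: comb_space_def)
  have "\<exists>z\<in>c00. comb_norm F (\<lambda>a. c * x a - z a) < \<epsilon>" if e: "\<epsilon> > 0" for \<epsilon>
  proof -
    have "\<epsilon> / norm c > 0" using e False by simp
    then obtain u where u: "u \<in> c00" "comb_norm F (\<lambda>a. x a - u a) < \<epsilon> / norm c"
      using x unfolding comb_space_def by blast
    have "(\<lambda>a. c * u a) \<in> c00" using u(1) by (auto simp: c00_def)
    moreover have "comb_norm F (\<lambda>a. c * (x a - u a)) < \<epsilon>"
      using comb_norm_scale[OF F comb_bounded_diff[of x F u], of c] u b
        c00_subset_comb_bounded[OF F] False by (fastforce simp: field_simps)
    ultimately show ?thesis
      by (intro bexI[of _ "\<lambda>a. c * u a"]) (simp_all add: algebra_simps)
  qed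
  then show ?thesis using comb_bounded_scale[OF b] by (simp add: comb_space_def)
qed

theorem c00_dense_comb_space:
  assumes "x \<in> comb_space F" "\<epsilon> > 0"
  shows "\<exists>y\<in>c00. comb_norm F (\<lambda>a. x a - y a) < \<epsilon>"
  using assms by (simp add: comb_space_def)

theorem comb_space_complete:
  fixes u :: "nat \<Rightarrow> 'k \<Rightarrow> 'a::{real_normed_field,banach}"
  assumes F: "family_on F"
    and u: "\<And>n. u n \<in> comb_space F"
    and cauchy: "\<And>\<epsilon>. \<epsilon> > 0 \<Longrightarrow> \<exists>N. \<forall>m\<ge>N. \<forall>n\<ge>N. comb_norm F (\<lambda>a. u m a - u n a) < \<epsilon>"
  shows "\<exists>x\<in>comb_space F. (\<lambda>n. comb_norm F (\<lambda>a. u n a - x a)) \<longlonglongrightarrow> 0"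
proof -
  have ub: "u n \<in> comb_bounded F" for n
    using u by (auto simp: comb_space_def)
  have "Cauchy (\<lambda>n. u n a)" for a
  proof (rule metric_CauchyI)
    fix \<epsilon> :: real assume "\<epsilon> > 0"
    then obtain N where N: "\<forall>m\<ge>N. \<forall>n\<ge>N. comb_norm F (\<lambda>a. u m a - u n a) < \<epsilon>"
      using cauchy by blast
    have "dist (u m a) (u n a) \<le> comb_norm F (\<lambda>a. u m a - u n a)" for m n
      using norm_le_comb_norm[OF F comb_bounded_diff[OF ub ub]] by (simp add: dist_norm)
    then show "\<exists>N. \<forall>m\<ge>N. \<forall>n\<ge>N. dist (u m a) (u n a) < \<epsilon>"
      using N le_less_trans by blast
  qed
  then have "convergent (\<lambda>n. u n a)" for a
    by (rule Cauchy_convergent)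
  then obtain x where x: "\<And>a. (\<lambda>n. u n a) \<longlonglongrightarrow> x a"
    unfolding convergent_def by metis
  have tail: "\<exists>N. \<forall>n\<ge>N. (\<lambda>a. u n a - x a) \<in> comb_bounded F \<and>
      comb_norm F (\<lambda>a. u n a - x a) < \<epsilon>" if "\<epsilon> > 0" for \<epsilon>
  proof -
    obtain N where N: "\<forall>m\<ge>N. \<forall>n\<ge>N. comb_norm F (\<lambda>a. u m a - u n a) < \<epsilon>/2"
      using cauchy[of "\<epsilon>/2"] \<open>\<epsilon> > 0\<close> by auto
    have le: "(\<Sum>a\<in>s. norm (u n a - x a)) \<le> \<epsilon>/2" if "n \<ge> N" "s \<in> F" for n s
    proof (rule LIMSEQ_le_const2)
      show "(\<lambda>m. \<Sum>a\<in>s. norm (u n a - u m a)) \<longlonglongrightarrow> (\<Sum>a\<in>s. norm (u n a - x a))"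
        by (intro tendsto_intros x)
      have "(\<Sum>a\<in>s. norm (u n a - u m a)) \<le> \<epsilon>/2" if "m \<ge> N" for m
        using sum_le_comb_norm[OF comb_bounded_diff[OF ub ub] \<open>s \<in> F\<close>, of n m] N \<open>n \<ge> N\<close> that
        by (meson less_imp_le order_trans)
      then show "\<exists>M. \<forall>m\<ge>M. (\<Sum>a\<in>s. norm (u n a - u m a)) \<le> \<epsilon>/2" by blast
    qed
    have "(\<lambda>a. u n a - x a) \<in> comb_bounded F \<and> comb_norm F (\<lambda>a. u n a - x a) < \<epsilon>"
      if "n \<ge> N" for n
      using comb_boundedI[of F "\<lambda>a. u n a - x a" "\<epsilon>/2"] \<open>\<epsilon> > 0\<close> le[OF that]
        comb_norm_le[OF F, of "\<lambda>a. u n a - x a" "\<epsilon>/2"] by force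
    then show ?thesis by blast
  qed
  have xb: "x \<in> comb_bounded F"
  proof -
    obtain n where "(\<lambda>a. u n a - x a) \<in> comb_bounded F" using tail[of 1] by auto
    from comb_bounded_diff[OF ub[of n] this] show ?thesis by simp
  qed
  have "\<exists>y\<in>c00. comb_norm F (\<lambda>a. x a - y a) < \<epsilon>" if e: "\<epsilon> > 0" for \<epsilon>
  proof -
    obtain n where n: "comb_norm F (\<lambda>a. u n a - x a) < \<epsilon>/2"
      using tail[of "\<epsilon>/2"] e by auto
    obtain y where y: "y \<in> c00" "comb_norm F (\<lambda>a. u n a - y a) < \<epsilon>/2"
      using c00_dense_comb_space[OF u, of "\<epsilon>/2" n] e by auto
    have "y \<in> comb_bounded F" using y(1) c00_subset_comb_bounded[OF F] by blast
    from comb_dist_triangle[OF F xb ub this, of n] n y show ?thesis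
      by (intro bexI[of _ y]) (simp_all add: comb_norm_minus_commute[of F x])
  qed
  with xb have "x \<in> comb_space F" by (simp add: comb_space_def)
  moreover have "(\<lambda>n. comb_norm F (\<lambda>a. u n a - x a)) \<longlonglongrightarrow> 0"
  proof (rule LIMSEQ_I)
    fix r :: real assume "r > 0"
    then obtain N where N: "\<forall>n\<ge>N. (\<lambda>a. u n a - x a) \<in> comb_bounded F \<and> comb_norm F (\<lambda>a. u n a - x a) < r"
      using tail by blast
    then have "norm (comb_norm F (\<lambda>a. u n a - x a) - 0) < r" if "n \<ge> N" for n
      using comb_norm_nonneg[OF F, of "\<lambda>a. u n a - x a"] that by simp
    then show "\<exists>N. \<forall>n\<ge>N. norm (comb_norm F (\<lambda>a. u n a - x a) - 0) < r" by blast
  qed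
  ultimately show ?thesis by blast
qed

end

theory Submission
  imports Defs
begin

text \<open>
  Write \<open>1\<^sub>s\<close> for the characteristic function of \<open>s\<close>. The argument compares the coordinate
  functionals of the two spaces and avoids any description of the extreme points of the dual
  ball; it only needs functionals of norm at most one (\<open>dual_ball\<close>).

  If \<open>s\<close> is maximal in \<open>G\<close>, then \<open>x = 1\<^sub>s\<close> has norm \<open>card s\<close>, and summation over \<open>s\<close> is the only
  functional of norm at most one that takes the value \<open>card s\<close> at \<open>x\<close>
  (\<open>unique_norming_functional_of_maximal_set\<close>): maximality allows \<open>x\<close> to be perturbed by \<open>e\<^sub>b\<close>,
  for \<open>b\<close> outside \<open>s\<close>, without increasing the norm. The preimage of \<open>x\<close> under \<open>T\<close> attains its
  norm on some \<open>u\<close> in \<open>F\<close>, because \<open>F\<close> is compact (\<open>comb_norm_attained\<close>), so it is normed by a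
  sum over \<open>u\<close> with unimodular weights. By uniqueness, summation over \<open>s\<close> composed with \<open>T\<close> is that
  weighted sum (\<open>maximal_sum_pullback\<close>).

  Since \<open>{\<alpha>}\<close> is a limit of maximal sets, the functional \<open>x \<mapsto> T x \<alpha>\<close> is a pointwise limit of such
  weighted sums. Regard \<open>T\<close> as the matrix with entries \<open>T e\<^sub>b \<alpha>\<close>. Then every row has entries of
  modulus 0 or 1 and its support belongs to \<open>F\<close> (\<open>isometry_matrix_row\<close>); in particular the row is
  finite and determines \<open>x \<mapsto> T x \<alpha>\<close>. The same holds for the inverse \<open>R\<close> of \<open>T\<close>.

  Moreover \<open>T e\<^sub>b\<close> has norm at most one, so in column \<open>b\<close> at most one of the rows indexed by a member
  of \<open>G\<close> is nonzero (\<open>isometry_column_disjoint\<close>). Hence the rows of \<open>R\<close> indexed by the support of row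
  \<open>\<alpha>\<close> of \<open>T\<close> have disjoint supports, and in the product \<open>T R = 1\<close> nothing cancels. Row \<open>\<alpha>\<close> of the
  identity has a single nonzero entry, so row \<open>\<alpha>\<close> of \<open>T\<close> has one too (\<open>isometry_row_singleton\<close>).
  A matrix all of whose rows, and all of whose inverse's rows, have one nonzero entry is a
  weighted permutation matrix.
\<close>

section \<open>Topology of families\<close>

lemma open_cylinder:
  fixes f :: "'k \<Rightarrow> bool"
  assumes "finite D"
  shows "open {g. \<forall>d\<in>D. g d = f d}"
proof -
  have "open ((\<lambda>g::'k \<Rightarrow> bool. g d) -` {f d})" for d
    by (intro open_vimage continuous_on_product_coordinates open_discrete)
  then have "open (\<Inter>d\<in>D. (\<lambda>g::'k \<Rightarrow> bool. g d) -` {f d})"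
    using assms by blast
  moreover have "(\<Inter>d\<in>D. (\<lambda>g::'k \<Rightarrow> bool. g d) -` {f d}) = {g. \<forall>d\<in>D. g d = f d}"
    by auto
  ultimately show ?thesis by simp
qed

lemma family_closure_iff:
  "S \<in> family_closure F \<longleftrightarrow> (\<forall>D. finite D \<longrightarrow> (\<exists>s\<in>F. s \<inter> D = S \<inter> D))"
proof
  assume S: "S \<in> family_closure F"
  show "\<forall>D. finite D \<longrightarrow> (\<exists>s\<in>F. s \<inter> D = S \<inter> D)"
  proof (intro allI impI)
    fix D :: "'a set" assume D: "finite D"
    have "\<exists>g \<in> chi ` F. g \<in> {g. \<forall>d\<in>D. g d = chi S d}"
      using S open_cylinder[OF D, of "chi S"] unfolding family_closure_def closure_iff_nhds_not_empty
      by (simp, blast)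
    then show "\<exists>s\<in>F. s \<inter> D = S \<inter> D" by (auto simp: chi_def)
  qed
next
  assume *: "\<forall>D. finite D \<longrightarrow> (\<exists>s\<in>F. s \<inter> D = S \<inter> D)"
  have "\<exists>g\<in>chi ` F. g \<in> U" if U: "open U" "chi S \<in> U" for U
  proof -
    have "openin (product_topology (\<lambda>i::'a. euclidean) UNIV) U"
      using U(1) by (simp add: open_fun_def)
    from product_topology_open_contains_basis[OF this U(2), unfolded topspace_euclidean]
    obtain X where X: "chi S \<in> Pi\<^sub>E UNIV X"
      "finite {i. X i \<noteq> (UNIV :: bool set)}" "Pi\<^sub>E UNIV X \<subseteq> U"
      by auto
    obtain s where s: "s \<in> F" "s \<inter> {i. X i \<noteq> UNIV} = S \<inter> {i. X i \<noteq> UNIV}"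
      using *[rule_format, OF X(2)] by (elim bexE) (rule that)
    have "chi s i \<in> X i" for i
    proof (cases "X i = UNIV")
      case False
      then have "chi s i = chi S i" using s(2) by (auto simp: chi_def)
      then show ?thesis using X(1) by (auto simp: PiE_iff)
    qed simp
    then show ?thesis using X(3) s(1) by (force simp: PiE_iff)
  qed
  then show "S \<in> family_closure F"
    unfolding family_closure_def closure_iff_nhds_not_empty by blast
qed

lemma inj_chi: "inj chi"
  by (auto simp: inj_def chi_def fun_eq_iff)

text \<open>Compactness provides finite character: the finite traces \<open>S \<inter> D\<close> are themselves members that
  converge to \<open>S\<close>. As members are finite, this also serves to show that a support is finite.\<close>

lemma compact_hereditary_memI:
  assumes "compact_family F" "hereditary F" "\<And>B. finite B \<Longrightarrow> B \<subseteq> S \<Longrightarrow> B \<in> F"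
  shows "S \<in> F"
proof -
  have "S \<in> family_closure F"
    unfolding family_closure_iff
  proof (intro allI impI)
    fix D :: "'a set" assume "finite D"
    then have "S \<inter> D \<in> F" by (intro assms(3)) auto
    then show "\<exists>s\<in>F. s \<inter> D = S \<inter> D" by (intro bexI[of _ "S \<inter> D"]) auto
  qed
  then have "chi S \<in> chi ` F"
    using assms(1) by (simp add: family_closure_def compact_family_def)
  then show ?thesis by (simp add: inj_image_mem_iff[OF inj_chi])
qed

lemma compact_chi_image:
  assumes "compact_family F"
  shows "compact (chi ` F)"
proof -
  have "compact_space (euclidean :: bool topology)"
    by (simp add: compact_space_def finite_imp_compact)
  then have "compact_space (product_topology (\<lambda>i::'a. euclidean :: bool topology) UNIV)"
    unfolding compact_space_product_topology by simp
  then have "compact (UNIV :: ('a \<Rightarrow> bool) set)"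
    by (simp only: compact_space_def euclidean_product_topology topspace_euclidean
        compactin_euclidean_iff)
  then show ?thesis
    using assms compact_Int_closed[of UNIV "chi ` F"] by (simp add: compact_family_def)
qed

section \<open>Uniformly small tails and attainment of the norm\<close>

text \<open>Elements of the completion are uniformly small, over all members of the family, away from a
  finite set. Every limit along members of the family rests on this estimate.\<close>

lemma comb_space_small_tails:
  fixes x :: "'k \<Rightarrow> 'a::real_normed_field"
  assumes F: "family_on F" and x: "x \<in> comb_space F" and e: "e > 0"
  obtains D where "finite D" "\<And>s. s \<in> F \<Longrightarrow> (\<Sum>a\<in>s - D. norm (x a)) < e"
proof -
  obtain y where y: "y \<in> c00" "comb_norm F (\<lambda>a. x a - y a) < e"
    using c00_dense_comb_space[OF x e] by blast
  define D where "D = {a. y a \<noteq> 0}"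
  have b: "(\<lambda>a. x a - y a) \<in> comb_bounded F"
    using x y(1) c00_subset_comb_bounded[OF F] by (intro comb_bounded_diff) (auto simp: comb_space_def)
  have "(\<Sum>a\<in>s - D. norm (x a)) < e" if s: "s \<in> F" for s
  proof -
    have "(\<Sum>a\<in>s - D. norm (x a)) = (\<Sum>a\<in>s - D. norm (x a - y a))"
      by (intro sum.cong) (auto simp: D_def)
    also have "\<dots> \<le> (\<Sum>a\<in>s. norm (x a - y a))"
      using s F by (intro sum_mono2) (auto simp: family_on_def)
    also have "\<dots> \<le> comb_norm F (\<lambda>a. x a - y a)"
      by (rule sum_le_comb_norm[OF b s])
    finally show ?thesis using y(2) by simp
  qed
  moreover have "finite D" using y(1) by (simp add: D_def c00_def)
  ultimately show thesis using that by blast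
qed

text \<open>By uniform smallness of tails, \<open>s \<mapsto> (\<Sum>a\<in>s. norm (x a))\<close> is continuous on the compact family.\<close>

lemma comb_norm_attained:
  fixes x :: "'k \<Rightarrow> 'a::real_normed_field"
  assumes F: "family_on F" "compact_family F" and x: "x \<in> comb_space F"
  obtains u where "u \<in> F" "(\<Sum>a\<in>u. norm (x a)) = comb_norm F x"
proof -
  define g where "g f = (\<Sum>a | f a. norm (x a))" for f :: "'k \<Rightarrow> bool"
  have g_chi: "g (chi s) = (\<Sum>a\<in>s. norm (x a))" for s
    by (simp add: g_def chi_def)
  have "(g \<longlongrightarrow> g (chi s)) (at (chi s) within chi ` F)" if s: "s \<in> F" for s
  proof (rule tendstoI)
    fix e :: real assume "e > 0"
    then obtain D where D: "finite D" "\<And>t. t \<in> F \<Longrightarrow> (\<Sum>a\<in>t - D. norm (x a)) < e"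
      using comb_space_small_tails[OF F(1) x] by blast
    have ev: "eventually (\<lambda>f. \<forall>d\<in>D. f d = chi s d) (at (chi s) within chi ` F)"
      unfolding eventually_at_topological
      by (intro exI[of _ "{f. \<forall>d\<in>D. f d = chi s d}"] conjI open_cylinder D(1)) auto
    have "eventually (\<lambda>f. f \<in> chi ` F) (at (chi s) within chi ` F)"
      by (auto simp: eventually_at_topological)
    with ev show "\<forall>\<^sub>F f in at (chi s) within chi ` F. dist (g f) (g (chi s)) < e"
    proof eventually_elim
      case (elim f)
      then obtain t where t: "t \<in> F" "f = chi t" by blast
      have split: "g (chi r) = (\<Sum>a\<in>r \<inter> D. norm (x a)) + (\<Sum>a\<in>r - D. norm (x a))"
        if "r \<in> F" for r
        unfolding g_chi using that F(1)
        by (subst sum.Int_Diff[of _ _ D]) (auto simp: family_on_def)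
      have "t \<inter> D = s \<inter> D" using elim t by (auto simp: chi_def)
      moreover have "0 \<le> (\<Sum>a\<in>r - D. norm (x a))" for r by (simp add: sum_nonneg)
      ultimately show ?case
        using D(2)[OF t(1)] D(2)[OF s] split[OF t(1)] split[OF s] unfolding t(2) dist_real_def
        by (smt (verit))
    qed
  qed
  then have cont: "continuous_on (chi ` F) g"
    unfolding continuous_on_def by blast
  have "chi ` F \<noteq> {}" using F(1) by (auto simp: family_on_def)
  from continuous_attains_sup[OF compact_chi_image[OF F(2)] this cont]
  obtain u where u: "u \<in> F" "\<And>s. s \<in> F \<Longrightarrow> g (chi s) \<le> g (chi u)"
    by auto
  have "comb_norm F x \<le> g (chi u)"
    using u(2) by (intro comb_norm_le[OF F(1)]) (simp add: g_chi)
  moreover have "g (chi u) \<le> comb_norm F x"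
    unfolding g_chi using x u(1) by (intro sum_le_comb_norm) (auto simp: comb_space_def)
  ultimately show thesis using that[OF u(1)] by (simp add: g_chi)
qed

section \<open>Contractive functionals\<close>

text \<open>The closed unit ball of the dual of the combinatorial space. HOL functions are total, so a
  functional is constrained on \<^term>\<open>comb_space F\<close> alone, and equality of functionals means equality there.\<close>

definition dual_ball :: "'k set set \<Rightarrow> (('k \<Rightarrow> 'a::real_normed_field) \<Rightarrow> 'a) set" where
  "dual_ball F = {\<phi>.
     (\<forall>x\<in>comb_space F. \<forall>y\<in>comb_space F. \<phi> (\<lambda>a. x a + y a) = \<phi> x + \<phi> y) \<and>
     (\<forall>c. \<forall>x\<in>comb_space F. \<phi> (\<lambda>a. c * x a) = c * \<phi> x) \<and>
     (\<forall>x\<in>comb_space F. norm (\<phi> x) \<le> comb_norm F x)}"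

lemma dual_ballD:
  assumes "\<phi> \<in> dual_ball F" "x \<in> comb_space F"
  shows "y \<in> comb_space F \<Longrightarrow> \<phi> (\<lambda>a. x a + y a) = \<phi> x + \<phi> y"
    and "\<phi> (\<lambda>a. c * x a) = c * \<phi> x"
    and "norm (\<phi> x) \<le> comb_norm F x"
  using assms by (auto simp: dual_ball_def)

lemma dual_ball_sum:
  fixes \<phi> :: "('k \<Rightarrow> 'a::real_normed_field) \<Rightarrow> 'a"
  assumes F: "family_on F" and \<phi>: "\<phi> \<in> dual_ball F" and "finite A"
  shows "(\<lambda>b. \<Sum>a\<in>A. c a * unit_vec a b) \<in> comb_space F \<and>
    \<phi> (\<lambda>b. \<Sum>a\<in>A. c a * unit_vec a b) = (\<Sum>a\<in>A. c a * \<phi> (unit_vec a))"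
  using \<open>finite A\<close>
proof induction
  case empty
  have "(\<lambda>b. 0 * unit_vec undefined b :: 'a) \<in> comb_space F"
    by (intro comb_space_scale F unit_vec_in_comb_space)
  moreover have "\<phi> (\<lambda>b. 0 * unit_vec undefined b) = 0 * \<phi> (unit_vec undefined)"
    by (intro dual_ballD[OF \<phi>] unit_vec_in_comb_space F)
  ultimately show ?case by simp
next
  case (insert a A)
  have "(\<lambda>b. c a * unit_vec a b) \<in> comb_space F"
    by (intro comb_space_scale F unit_vec_in_comb_space)
  note mem = this insert.IH[THEN conjunct1]
  show ?case
    using insert.hyps insert.IH comb_space_add[OF F mem] dual_ballD(1)[OF \<phi> mem]
      dual_ballD(2)[OF \<phi> unit_vec_in_comb_space[OF F]]
    by simp
qed

lemma c00_expansion: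
  assumes "finite A" "\<And>a. a \<notin> A \<Longrightarrow> y a = 0"
  shows "y = (\<lambda>b. \<Sum>a\<in>A. y a * unit_vec a b)"
proof
  fix b
  have "(\<Sum>a\<in>A. y a * unit_vec a b) = (\<Sum>a\<in>A. if b = a then y a else 0)"
    by (intro sum.cong) (auto simp: unit_vec_def)
  also have "\<dots> = y b"
    using assms by (simp add: sum.delta)
  finally show "y b = (\<Sum>a\<in>A. y a * unit_vec a b)" by simp
qed

lemma comb_space_diff:
  "family_on F \<Longrightarrow> x \<in> comb_space F \<Longrightarrow> y \<in> comb_space F \<Longrightarrow> (\<lambda>a. x a - y a) \<in> comb_space F"
  using comb_space_add[of F x "\<lambda>a. -1 * y a"] comb_space_scale[of F y "-1"] by simp

lemma dual_ball_eqI: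
  fixes \<phi> \<psi> :: "('k \<Rightarrow> 'a::real_normed_field) \<Rightarrow> 'a"
  assumes F: "family_on F" and \<phi>: "\<phi> \<in> dual_ball F" and \<psi>: "\<psi> \<in> dual_ball F"
    and eq: "\<And>a. \<phi> (unit_vec a) = \<psi> (unit_vec a)" and x: "x \<in> comb_space F"
  shows "\<phi> x = \<psi> x"
proof -
  have "norm (\<phi> x - \<psi> x) \<le> 0 + e" if "e > 0" for e :: real
  proof -
    obtain y where y: "y \<in> c00" "comb_norm F (\<lambda>a. x a - y a) < e / 2"
      using c00_dense_comb_space[OF x] \<open>e > 0\<close> half_gt_zero by blast
    have fin: "finite {a. y a \<noteq> 0}" using y(1) by (simp add: c00_def)
    have expand: "y = (\<lambda>b. \<Sum>a\<in>{a. y a \<noteq> 0}. y a * unit_vec a b)"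
      by (rule c00_expansion[OF fin]) simp
    have "\<phi> y = \<psi> y"
      using dual_ball_sum[OF F \<phi> fin, of y] dual_ball_sum[OF F \<psi> fin, of y] eq
      unfolding expand[symmetric] by simp
    have ys: "y \<in> comb_space F" using y(1) c00_subset_comb_space[OF F] by blast
    note d = comb_space_diff[OF F x ys]
    have "\<phi> x = \<phi> (\<lambda>a. x a - y a) + \<phi> y" "\<psi> x = \<psi> (\<lambda>a. x a - y a) + \<psi> y"
      using dual_ballD(1)[OF \<phi> d ys] dual_ballD(1)[OF \<psi> d ys] by simp_all
    then have "\<phi> x - \<psi> x = \<phi> (\<lambda>a. x a - y a) - \<psi> (\<lambda>a. x a - y a)"
      using \<open>\<phi> y = \<psi> y\<close> by simp
    then have "norm (\<phi> x - \<psi> x) \<le> norm (\<phi> (\<lambda>a. x a - y a)) + norm (\<psi> (\<lambda>a. x a - y a))"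
      by (simp add: norm_triangle_ineq4)
    also have "\<dots> \<le> e / 2 + e / 2"
      using dual_ballD(3)[OF \<phi> d] dual_ballD(3)[OF \<psi> d] y(2) by simp
    finally show ?thesis by simp
  qed
  then have "norm (\<phi> x - \<psi> x) \<le> 0" by (rule field_le_epsilon)
  then show ?thesis by simp
qed

lemma weighted_sum_in_dual_ball:
  fixes c :: "'k \<Rightarrow> 'a::real_normed_field"
  assumes "s \<in> F" "\<And>a. a \<in> s \<Longrightarrow> norm (c a) \<le> 1"
  shows "(\<lambda>x. \<Sum>a\<in>s. c a * x a) \<in> dual_ball F"
proof -
  have "norm (\<Sum>a\<in>s. c a * x a) \<le> comb_norm F x" if "x \<in> comb_space F" for x
  proof -
    have "norm (\<Sum>a\<in>s. c a * x a) \<le> (\<Sum>a\<in>s. norm (x a))"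
      by (rule sum_norm_le) (use assms(2) in \<open>auto simp: norm_mult mult_left_le_one_le\<close>)
    also have "\<dots> \<le> comb_norm F x"
      using that assms(1) by (intro sum_le_comb_norm) (auto simp: comb_space_def)
    finally show ?thesis .
  qed
  then show ?thesis
    by (auto simp: dual_ball_def sum.distrib[symmetric] sum_distrib_left algebra_simps)
qed

lemma coordinate_in_dual_ball:
  assumes "family_on F"
  shows "(\<lambda>x. x a) \<in> dual_ball F"
  using weighted_sum_in_dual_ball[of "{a}" F "\<lambda>_. 1"] assms by (simp add: family_on_def)

lemma comb_isometryD:
  assumes "comb_isometry F G T"
  shows "bij_betw T (comb_space F) (comb_space G)"
    and "x \<in> comb_space F \<Longrightarrow> T x \<in> comb_space G"
    and "x \<in> comb_space F \<Longrightarrow> y \<in> comb_space F \<Longrightarrow> T (\<lambda>a. x a + y a) = (\<lambda>a. T x a + T y a)"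
    and "x \<in> comb_space F \<Longrightarrow> T (\<lambda>a. c * x a) = (\<lambda>a. c * T x a)"
    and "x \<in> comb_space F \<Longrightarrow> comb_norm G (T x) = comb_norm F x"
  using assms by (auto simp: comb_isometry_def dest: bij_betwE)

lemma dual_ball_pullback:
  assumes "comb_isometry F G T" "\<phi> \<in> dual_ball G"
  shows "(\<lambda>x. \<phi> (T x)) \<in> dual_ball F"
  unfolding dual_ball_def
  using comb_isometryD[OF assms(1)] dual_ballD[OF assms(2)]
  by simp metis

lemma comb_isometry_inverse:
  fixes T :: "('k \<Rightarrow> 'a::real_normed_field) \<Rightarrow> 'k \<Rightarrow> 'a"
  assumes F: "family_on F" and T: "comb_isometry F G T"
  obtains R where "comb_isometry G F R"
    "\<And>x. x \<in> comb_space F \<Longrightarrow> R (T x) = x" "\<And>y. y \<in> comb_space G \<Longrightarrow> T (R y) = y"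
proof -
  note TD = comb_isometryD[OF T]
  define R where "R = inv_into (comb_space F) T"
  have R_T: "R (T x) = x" if "x \<in> comb_space F" for x
    unfolding R_def using TD(1) that by (rule bij_betw_inv_into_left)
  have T_R: "T (R y) = y" if "y \<in> comb_space G" for y
    unfolding R_def using TD(1) that by (rule bij_betw_inv_into_right)
  have bij: "bij_betw R (comb_space G) (comb_space F)"
    unfolding R_def by (rule bij_betw_inv_into[OF TD(1)])
  then have mem: "R y \<in> comb_space F" if "y \<in> comb_space G" for y
    using that by (auto dest: bij_betwE)
  have "R (\<lambda>a. x a + y a) = (\<lambda>a. R x a + R y a)" if "x \<in> comb_space G" "y \<in> comb_space G" for x y
    using R_T[OF comb_space_add[OF F mem[OF that(1)] mem[OF that(2)]]]
      TD(3)[OF mem[OF that(1)] mem[OF that(2)]] T_R that by simp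
  moreover have "R (\<lambda>a. c * x a) = (\<lambda>a. c * R x a)" if "x \<in> comb_space G" for c x
    using R_T[OF comb_space_scale[OF F mem[OF that]]] TD(4)[OF mem[OF that]] T_R that by simp
  moreover have "comb_norm F (R x) = comb_norm G x" if "x \<in> comb_space G" for x
    using TD(5)[OF mem[OF that]] T_R[OF that] by simp
  ultimately have "comb_isometry G F R"
    using bij by (simp add: comb_isometry_def)
  then show thesis using that R_T T_R by blast
qed

section \<open>Sums over maximal sets\<close>

lemma comb_norm_unit_vec:
  assumes "family_on F"
  shows "comb_norm F (unit_vec a :: 'k \<Rightarrow> 'a::real_normed_field) \<le> 1"
proof (rule comb_norm_le[OF assms])
  fix s assume "s \<in> F"
  then have "finite s" using assms by (simp add: family_on_def)
  have "(\<Sum>b\<in>s. norm (unit_vec a b :: 'a)) = (\<Sum>b\<in>s. if b = a then 1 else 0)"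
    by (intro sum.cong) (auto simp: unit_vec_def)
  then show "(\<Sum>b\<in>s. norm (unit_vec a b :: 'a)) \<le> 1"
    using \<open>finite s\<close> by simp
qed

text \<open>A member of the family that contains \<open>b\<close> misses some element of the maximal set \<open>s\<close>, so what it
  gains at \<open>b\<close> it loses on \<open>s\<close>.\<close>

lemma comb_norm_maximal_set_plus_unit_vec:
  fixes c :: "'a::real_normed_field"
  assumes G: "family_on G" and s: "s \<in> maximal_sets G" and b: "b \<notin> s" and c: "norm c \<le> 1"
  shows "comb_norm G (\<lambda>a. (if a \<in> s then 1 else 0) + c * unit_vec b a) \<le> real (card s)"
    (is "comb_norm G ?x \<le> _")
proof (rule comb_norm_le[OF G])
  fix t assume t: "t \<in> G"
  have fin: "finite t" "finite s" using G t s by (auto simp: family_on_def maximal_sets_def)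
  have "(\<Sum>a\<in>t. norm (?x a)) \<le> (\<Sum>a\<in>t. (if a \<in> s then 1 else 0) + (if a = b then 1 else 0))"
    using c b by (intro sum_mono) (auto simp: unit_vec_def)
  also have "\<dots> = real (card (t \<inter> s)) + (if b \<in> t then 1 else 0)"
    using fin by (simp add: sum.distrib sum.delta flip: sum.inter_restrict)
  also have "\<dots> \<le> real (card s)"
  proof (cases "b \<in> t")
    case True
    then have "t \<inter> s \<subset> s" using s t b by (auto simp: maximal_sets_def)
    then have "card (t \<inter> s) < card s" using fin by (intro psubset_card_mono)
    then show ?thesis by simp
  next
    case False
    then show ?thesis using fin by (simp add: card_mono)
  qed
  finally show "(\<Sum>a\<in>t. norm (?x a)) \<le> real (card s)" .
qed

text \<open>Strict convexity of the scalar field, which is why the scalars carry an inner product: the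
  class covers both the real and the complex numbers.\<close>

lemma eq_one_if_sum_eq_card:
  fixes w :: "'k \<Rightarrow> 'a::{real_normed_field, real_inner}"
  assumes "finite s" "\<And>a. a \<in> s \<Longrightarrow> norm (w a) \<le> 1" "(\<Sum>a\<in>s. w a) = of_nat (card s)" "a \<in> s"
  shows "w a = 1"
proof -
  have le: "inner (w b) 1 \<le> 1" if "b \<in> s" for b
    using norm_cauchy_schwarz[of "w b" 1] assms(2)[OF that] by simp
  have "inner (of_nat n :: 'a) 1 = real n" for n
    by (induction n) (simp_all add: inner_add_left dot_square_norm)
  then have "(\<Sum>b\<in>s. 1 - inner (w b) 1) = 0"
    using assms(3) by (simp add: sum_subtractf flip: inner_sum_left)
  then have "inner (w a) 1 = 1"
    using sum_nonneg_0[OF assms(1), of "\<lambda>b. 1 - inner (w b) 1" a] le assms(4) by simp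
  then have "(norm (w a - 1))\<^sup>2 = (norm (w a))\<^sup>2 - 1"
    by (simp add: power2_norm_eq_inner inner_diff_left inner_diff_right
        inner_commute[of 1 "w a"] dot_square_norm[of 1])
  also have "\<dots> \<le> 0" using assms(2)[OF assms(4)] by (simp add: power_le_one)
  finally show ?thesis by simp
qed

text \<open>On the basis vectors of \<open>s\<close> the functional is forced to be 1 by strict convexity. A nonzero value
  at \<open>e\<^sub>b\<close> with \<open>b\<close> outside \<open>s\<close> would, after rotating \<open>e\<^sub>b\<close>, yield a value above the norm of the
  perturbed vector.\<close>

lemma unique_norming_functional_of_maximal_set:
  fixes \<phi> :: "('k \<Rightarrow> 'a::{real_normed_field, real_inner}) \<Rightarrow> 'a"
  assumes G: "family_on G" and s: "s \<in> maximal_sets G" and \<phi>: "\<phi> \<in> dual_ball G"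
    and norming: "\<phi> (\<lambda>a. if a \<in> s then 1 else 0) = of_nat (card s)"
    and z: "z \<in> comb_space G"
  shows "\<phi> z = (\<Sum>a\<in>s. z a)"
proof -
  let ?x = "\<lambda>a. if a \<in> s then 1 else 0 :: 'a"
  have sG: "s \<in> G" "finite s" using s G by (auto simp: maximal_sets_def family_on_def)
  have x_eq: "?x = (\<lambda>b. \<Sum>a\<in>s. ?x a * unit_vec a b)"
    by (rule c00_expansion[OF sG(2)]) simp
  have x: "?x \<in> comb_space G" and \<phi>x: "\<phi> ?x = (\<Sum>a\<in>s. \<phi> (unit_vec a))"
    using dual_ball_sum[OF G \<phi> sG(2), of ?x] unfolding x_eq[symmetric] by simp_all
  have on_s: "\<phi> (unit_vec b) = 1" if "b \<in> s" for b
  proof (rule eq_one_if_sum_eq_card[OF sG(2) _ _ that])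
    show "norm (\<phi> (unit_vec a)) \<le> 1" for a
      using dual_ballD(3)[OF \<phi> unit_vec_in_comb_space[OF G]] comb_norm_unit_vec[OF G] order_trans
      by blast
    show "(\<Sum>a\<in>s. \<phi> (unit_vec a)) = of_nat (card s)"
      using \<phi>x norming by simp
  qed
  have off_s: "\<phi> (unit_vec b) = 0" if b: "b \<notin> s" for b
  proof (rule ccontr)
    let ?w = "\<phi> (unit_vec b)"
    assume w: "?w \<noteq> 0"
    \<comment> \<open>The scalar rotates the value at \<open>e\<^sub>b\<close> onto the positive real axis.\<close>
    define c where "c = of_real (norm ?w) / ?w"
    have c: "norm c = 1" "c * ?w = of_real (norm ?w)"
      using w by (simp_all add: c_def norm_divide)
    have cb: "(\<lambda>a. c * unit_vec b a) \<in> comb_space G"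
      by (intro comb_space_scale unit_vec_in_comb_space G)
    have "\<phi> (\<lambda>a. ?x a + c * unit_vec b a) = of_nat (card s) + of_real (norm ?w)"
      using dual_ballD(1)[OF \<phi> x cb] dual_ballD(2)[OF \<phi> unit_vec_in_comb_space[OF G], of c b]
        norming c(2) by simp
    also have "\<dots> = of_real (real (card s) + norm ?w)" by simp
    finally have "norm (\<phi> (\<lambda>a. ?x a + c * unit_vec b a)) = real (card s) + norm ?w"
      unfolding norm_of_real by (metis abs_of_nonneg add_nonneg_nonneg norm_ge_zero norm_of_real of_nat_0_le_iff)
    moreover have "norm (\<phi> (\<lambda>a. ?x a + c * unit_vec b a)) \<le> real (card s)"
      using dual_ballD(3)[OF \<phi> comb_space_add[OF G x cb]]
        comb_norm_maximal_set_plus_unit_vec[OF G s b, of c] c(1) by simp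
    ultimately show False using w by simp
  qed
  have "(\<lambda>x. \<Sum>a\<in>s. x a) \<in> dual_ball G"
    using weighted_sum_in_dual_ball[OF sG(1), of "\<lambda>_. 1"] by simp
  then show ?thesis
  proof (rule dual_ball_eqI[OF G \<phi> _ _ z])
    fix b
    have "(\<Sum>a\<in>s. unit_vec b a :: 'a) = (if b \<in> s then 1 else 0)"
      using sG(2) by (simp add: unit_vec_def)
    then show "\<phi> (unit_vec b) = (\<Sum>a\<in>s. unit_vec b a)"
      using on_s off_s by simp
  qed
qed

text \<open>The weighted sum that norms the preimage of \<open>1\<^sub>s\<close> becomes, after composing with the inverse of
  \<open>T\<close>, a functional that norms \<open>1\<^sub>s\<close>, hence summation over \<open>s\<close>. Only the moduli of the weights at
  basis vectors are recorded.\<close>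

lemma maximal_sum_pullback:
  fixes T :: "('k \<Rightarrow> 'a::{real_normed_field, real_inner}) \<Rightarrow> 'k \<Rightarrow> 'a"
  assumes F: "family_on F" "compact_family F" and G: "family_on G"
    and T: "comb_isometry F G T" and s: "s \<in> maximal_sets G"
  obtains u where "u \<in> F"
    "\<And>b. norm (\<Sum>a\<in>s. T (unit_vec b) a) = (if b \<in> u then 1 else 0)"
proof -
  let ?x = "\<lambda>a. if a \<in> s then 1 else 0 :: 'a"
  have sG: "s \<in> G" "finite s" using s G by (auto simp: maximal_sets_def family_on_def)
  have x: "?x \<in> comb_space G"
    using c00_subset_comb_space[OF G] sG(2) by (auto simp: c00_def)
  have norm_x: "comb_norm G ?x = real (card s)"
  proof (rule antisym)
    show "comb_norm G ?x \<le> real (card s)"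
    proof (rule comb_norm_le[OF G])
      fix t assume "t \<in> G"
      then have "finite t" using G by (simp add: family_on_def)
      have "(\<Sum>a\<in>t. norm (?x a)) = (\<Sum>a\<in>t. if a \<in> s then 1 else 0)"
        by (intro sum.cong) auto
      also have "\<dots> = real (card (t \<inter> s))"
        using \<open>finite t\<close> by (simp flip: sum.inter_restrict)
      also have "\<dots> \<le> real (card s)" using sG(2) by (simp add: card_mono)
      finally show "(\<Sum>a\<in>t. norm (?x a)) \<le> real (card s)" .
    qed
    have "(\<Sum>a\<in>s. norm (?x a)) \<le> comb_norm G ?x"
      using x sG(1) by (intro sum_le_comb_norm) (auto simp: comb_space_def)
    then show "real (card s) \<le> comb_norm G ?x" by simp
  qed
  obtain R where R: "comb_isometry G F R"
    "\<And>x. x \<in> comb_space F \<Longrightarrow> R (T x) = x" "\<And>y. y \<in> comb_space G \<Longrightarrow> T (R y) = y"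
    using comb_isometry_inverse[OF F(1) T] by blast
  have y: "R ?x \<in> comb_space F" by (rule comb_isometryD(2)[OF R(1) x])
  obtain u where u: "u \<in> F" "(\<Sum>a\<in>u. norm (R ?x a)) = comb_norm F (R ?x)"
    using comb_norm_attained[OF F y] by blast
  \<comment> \<open>Where the preimage vanishes, any unimodular weight serves.\<close>
  define c where "c a = (if R ?x a = 0 then 1 else of_real (norm (R ?x a)) / R ?x a)" for a
  have c: "norm (c a) = 1" "c a * R ?x a = of_real (norm (R ?x a))" for a
    by (simp_all add: c_def norm_divide)
  define f where "f z = (\<Sum>a\<in>u. c a * z a)" for z :: "'k \<Rightarrow> 'a"
  have f: "f \<in> dual_ball F"
    unfolding f_def by (rule weighted_sum_in_dual_ball[OF u(1)]) (simp add: c)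
  have "f (R ?x) = of_real (\<Sum>a\<in>u. norm (R ?x a))"
    by (simp add: f_def c)
  also have "\<dots> = of_nat (card s)"
    using u(2) comb_isometryD(5)[OF R(1) x] norm_x by simp
  finally have norming: "f (R ?x) = of_nat (card s)" .
  have key: "f (R z) = (\<Sum>a\<in>s. z a)" if "z \<in> comb_space G" for z
    by (rule unique_norming_functional_of_maximal_set[OF G s dual_ball_pullback[OF R(1) f] norming that])
  have "norm (\<Sum>a\<in>s. T (unit_vec b) a) = (if b \<in> u then 1 else 0)" for b
  proof -
    have e: "unit_vec b \<in> comb_space F" by (rule unit_vec_in_comb_space[OF F(1)])
    have "(\<Sum>a\<in>s. T (unit_vec b) a) = f (unit_vec b)"
      using key[OF comb_isometryD(2)[OF T e]] R(2)[OF e] by simp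
    also have "\<dots> = (\<Sum>a\<in>u. if a = b then c a else 0)"
      unfolding f_def by (intro sum.cong) (auto simp: unit_vec_def)
    also have "\<dots> = (if b \<in> u then c b else 0)"
      using u(1) F(1) by (simp add: family_on_def)
    finally show ?thesis using c(1) by simp
  qed
  then show thesis by (rule that[OF u(1)])
qed

section \<open>The matrix of an isometry\<close>

text \<open>Choose \<open>s\<close> so close to \<open>{\<alpha>}\<close> that it meets the essential supports of all \<open>z i\<close> in \<open>\<alpha>\<close> at most;
  the remaining part of the sum over \<open>s\<close> is then a small tail.\<close>

lemma maximal_sums_approximate_coordinate:
  fixes z :: "'i \<Rightarrow> 'k \<Rightarrow> 'a::real_normed_field"
  assumes G: "family_on G" and \<alpha>: "{\<alpha>} \<in> family_closure (maximal_sets G)"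
    and B: "finite B" "\<And>i. i \<in> B \<Longrightarrow> z i \<in> comb_space G" and e: "e > 0"
  obtains s where "s \<in> maximal_sets G" "\<And>i. i \<in> B \<Longrightarrow> norm ((\<Sum>a\<in>s. z i a) - z i \<alpha>) < e"
proof -
  have "\<exists>D. finite D \<and> (\<forall>s\<in>G. (\<Sum>a\<in>s - D. norm (z i a)) < e)" if "i \<in> B" for i
    by (rule comb_space_small_tails[OF G B(2)[OF that] e]) blast
  then obtain D where D: "\<And>i. i \<in> B \<Longrightarrow> finite (D i)"
    "\<And>i s. i \<in> B \<Longrightarrow> s \<in> G \<Longrightarrow> (\<Sum>a\<in>s - D i. norm (z i a)) < e"
    by metis
  let ?D = "insert \<alpha> (\<Union>i\<in>B. D i)"
  have "finite ?D" using B(1) D(1) by simp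
  from \<alpha>[unfolded family_closure_iff, rule_format, OF this]
  obtain s where s: "s \<in> maximal_sets G"
    "s \<inter> ?D = {\<alpha>} \<inter> ?D"
    by (elim bexE) (rule that)
  have sG: "s \<in> G" "finite s" using s G by (auto simp: maximal_sets_def family_on_def)
  have "\<alpha> \<in> s" using s(2) by blast
  have "norm ((\<Sum>a\<in>s. z i a) - z i \<alpha>) < e" if i: "i \<in> B" for i
  proof -
    have "(\<Sum>a\<in>s. z i a) - z i \<alpha> = (\<Sum>a\<in>s - {\<alpha>}. z i a)"
      using sG(2) \<open>\<alpha> \<in> s\<close> by (simp add: sum.remove)
    also have "norm \<dots> \<le> (\<Sum>a\<in>s - {\<alpha>}. norm (z i a))"
      by (rule norm_sum)
    also have "\<dots> \<le> (\<Sum>a\<in>s - D i. norm (z i a))"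
      using sG(2) s(2) i by (intro sum_mono2) auto
    also have "\<dots> < e" by (rule D(2)[OF i sG(1)])
    finally show ?thesis .
  qed
  then show thesis by (rule that[OF s(1)])
qed

text \<open>The moduli in a row are limits of the values 0 and 1 given by \<open>maximal_sum_pullback\<close>, and any
  finite part of the support of the row lies in a set \<open>u\<close> of \<open>F\<close>; finite character does the rest.\<close>

lemma isometry_matrix_row:
  fixes T :: "('k \<Rightarrow> 'a::{real_normed_field, real_inner}) \<Rightarrow> 'k \<Rightarrow> 'a"
  assumes F: "family_on F" "compact_family F" "hereditary F" and G: "family_on G"
    and \<alpha>: "{\<alpha>} \<in> family_closure (maximal_sets G)" and T: "comb_isometry F G T"
  shows "T (unit_vec b) \<alpha> \<noteq> 0 \<Longrightarrow> norm (T (unit_vec b) \<alpha>) = 1"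
    and "{b. T (unit_vec b) \<alpha> \<noteq> 0} \<in> F"
proof -
  have mem: "T (unit_vec b) \<in> comb_space G" for b
    by (intro comb_isometryD(2)[OF T] unit_vec_in_comb_space F)
  have approx: "\<exists>u\<in>F. \<forall>b\<in>B. \<bar>(if b \<in> u then 1 else 0) - norm (T (unit_vec b) \<alpha>)\<bar> < e"
    if B: "finite B" and e: "e > 0" for B and e :: real
  proof -
    obtain s where s: "s \<in> maximal_sets G"
      "\<And>b. b \<in> B \<Longrightarrow> norm ((\<Sum>a\<in>s. T (unit_vec b) a) - T (unit_vec b) \<alpha>) < e"
      using maximal_sums_approximate_coordinate[OF G \<alpha> B, of "\<lambda>b. T (unit_vec b)", OF mem e]
      by blast
    obtain u where u: "u \<in> F"
      "\<And>b. norm (\<Sum>a\<in>s. T (unit_vec b) a) = (if b \<in> u then 1 else 0)"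
      using maximal_sum_pullback[OF F(1,2) G T s(1)] by blast
    have "\<bar>(if b \<in> u then 1 else 0) - norm (T (unit_vec b) \<alpha>)\<bar> < e" if "b \<in> B" for b
      using norm_triangle_ineq3[of "\<Sum>a\<in>s. T (unit_vec b) a" "T (unit_vec b) \<alpha>"] s(2)[OF that]
      unfolding u(2)[symmetric] by (rule le_less_trans)
    then show ?thesis using u(1) by blast
  qed
  show unimodular: "norm (T (unit_vec b) \<alpha>) = 1" if "T (unit_vec b) \<alpha> \<noteq> 0" for b
  proof (rule ccontr)
    define r where "r = norm (T (unit_vec b) \<alpha>)"
    assume "norm (T (unit_vec b) \<alpha>) \<noteq> 1"
    then have r: "r > 0" "r \<noteq> 1" using that by (auto simp: r_def)
    then have "min r \<bar>1 - r\<bar> > 0" by simp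
    from approx[OF _ this, of "{b}"]
    obtain u where "\<bar>(if b \<in> u then 1 else 0) - r\<bar> < min r \<bar>1 - r\<bar>"
      unfolding r_def by fastforce
    then show False using r(1) by (auto split: if_splits)
  qed
  show "{b. T (unit_vec b) \<alpha> \<noteq> 0} \<in> F"
  proof (rule compact_hereditary_memI[OF F(2,3)])
    fix B assume B: "finite B" "B \<subseteq> {b. T (unit_vec b) \<alpha> \<noteq> 0}"
    then obtain u where u: "u \<in> F" "\<forall>b\<in>B. \<bar>(if b \<in> u then 1 else 0) - norm (T (unit_vec b) \<alpha>)\<bar> < 1"
      using approx[of B 1] by auto
    \<comment> \<open>The entries over \<open>B\<close> have modulus 1, so an error below 1 already forces \<open>b \<in> u\<close>.\<close>
    have "B \<subseteq> u"
    proof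
      fix b assume b: "b \<in> B"
      then have "norm (T (unit_vec b) \<alpha>) = 1" using unimodular B(2) by blast
      then show "b \<in> u" using u(2) b by (auto split: if_splits)
    qed
    then show "B \<in> F" using F(3) u(1) by (auto simp: hereditary_def)
  qed
qed

text \<open>Preimages of basis vectors need not be finitely supported, so the row is needed as a formula on
  the whole space. Both sides are bounded functionals that agree on the basis.\<close>

lemma isometry_coordinate_expansion:
  fixes T :: "('k \<Rightarrow> 'a::{real_normed_field, real_inner}) \<Rightarrow> 'k \<Rightarrow> 'a"
  assumes F: "family_on F" "compact_family F" "hereditary F" and G: "family_on G"
    and \<alpha>: "{\<alpha>} \<in> family_closure (maximal_sets G)" and T: "comb_isometry F G T"
    and x: "x \<in> comb_space F"
  shows "T x \<alpha> = (\<Sum>b | T (unit_vec b) \<alpha> \<noteq> 0. T (unit_vec b) \<alpha> * x b)"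
proof (rule dual_ball_eqI[OF F(1) _ _ _ x])
  note row = isometry_matrix_row[OF F G \<alpha> T]
  show "(\<lambda>x. T x \<alpha>) \<in> dual_ball F"
    by (rule dual_ball_pullback[OF T coordinate_in_dual_ball[OF G]])
  show "(\<lambda>x. \<Sum>b | T (unit_vec b) \<alpha> \<noteq> 0. T (unit_vec b) \<alpha> * x b) \<in> dual_ball F"
    by (rule weighted_sum_in_dual_ball[OF row(2)]) (simp add: row(1))
  fix a
  have fin: "finite {b. T (unit_vec b) \<alpha> \<noteq> 0}" using row(2) F(1) by (simp add: family_on_def)
  have "(\<Sum>b | T (unit_vec b) \<alpha> \<noteq> 0. T (unit_vec b) \<alpha> * unit_vec a b) =
      (\<Sum>b | T (unit_vec b) \<alpha> \<noteq> 0. if b = a then T (unit_vec b) \<alpha> else 0)"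
    by (intro sum.cong) (auto simp: unit_vec_def)
  also have "\<dots> = T (unit_vec a) \<alpha>"
    using fin by simp
  finally show "T (unit_vec a) \<alpha> = (\<Sum>b | T (unit_vec b) \<alpha> \<noteq> 0. T (unit_vec b) \<alpha> * unit_vec a b)"
    by simp
qed

lemma isometry_matrix_row_nonempty:
  fixes T :: "('k \<Rightarrow> 'a::{real_normed_field, real_inner}) \<Rightarrow> 'k \<Rightarrow> 'a"
  assumes F: "family_on F" "compact_family F" "hereditary F" and G: "family_on G"
    and \<alpha>: "{\<alpha>} \<in> family_closure (maximal_sets G)" and T: "comb_isometry F G T"
  obtains b where "T (unit_vec b) \<alpha> \<noteq> 0"
proof -
  obtain x where x: "x \<in> comb_space F" "T x = unit_vec \<alpha>"
    using comb_isometryD(1)[OF T] unit_vec_in_comb_space[OF G] by (metis bij_betw_iff_bijections)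
  have "T x \<alpha> \<noteq> 0" by (simp add: x(2) unit_vec_def)
  then show thesis
    using isometry_coordinate_expansion[OF F G \<alpha> T x(1)] that by (metis (mono_tags, lifting) Collect_empty_eq sum.empty)
qed

text \<open>Two entries of modulus 1 in positions from one set of \<open>G\<close> would give \<open>T e\<^sub>b\<close> norm at least 2.\<close>

lemma isometry_column_disjoint:
  fixes T :: "('k \<Rightarrow> 'a::{real_normed_field, real_inner}) \<Rightarrow> 'k \<Rightarrow> 'a"
  assumes F: "family_on F" "compact_family F" "hereditary F" and G: "family_on G"
    and cl: "\<And>\<alpha>. {\<alpha>} \<in> family_closure (maximal_sets G)" and T: "comb_isometry F G T"
    and s: "s \<in> G" "\<alpha> \<in> s" "\<beta> \<in> s" and nz: "T (unit_vec b) \<alpha> \<noteq> 0" "T (unit_vec b) \<beta> \<noteq> 0"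
  shows "\<alpha> = \<beta>"
proof (rule ccontr)
  assume ne: "\<alpha> \<noteq> \<beta>"
  have e: "unit_vec b \<in> comb_space F" by (rule unit_vec_in_comb_space[OF F(1)])
  have "2 = (\<Sum>a\<in>{\<alpha>, \<beta>}. norm (T (unit_vec b) a))"
    using ne isometry_matrix_row(1)[OF F G cl T] nz by simp
  also have "\<dots> \<le> (\<Sum>a\<in>s. norm (T (unit_vec b) a))"
    using s G by (intro sum_mono2) (auto simp: family_on_def)
  also have "\<dots> \<le> comb_norm G (T (unit_vec b))"
    using comb_isometryD(2)[OF T e] s(1) by (intro sum_le_comb_norm) (auto simp: comb_space_def)
  also have "\<dots> \<le> 1"
    using comb_isometryD(5)[OF T e] comb_norm_unit_vec[OF F(1), of b, where ?'a = 'a] by simp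
  finally show False by simp
qed

text \<open>For \<open>b\<close> in the support of row \<open>\<alpha>\<close> of \<open>T\<close>, disjointness leaves a single summand in the entries of
  \<open>T R\<close> in row \<open>\<alpha>\<close>, so row \<open>b\<close> of \<open>R\<close> is supported in \<open>{\<alpha>}\<close> alone. Disjointness of these nonempty
  supports then excludes a second \<open>b\<close>.\<close>

lemma isometry_row_singleton:
  fixes T R :: "('k \<Rightarrow> 'a::{real_normed_field, real_inner}) \<Rightarrow> 'k \<Rightarrow> 'a"
  assumes F: "family_on F" "compact_family F" "hereditary F"
    and G: "family_on G" "compact_family G" "hereditary G"
    and clF: "\<And>\<alpha>. {\<alpha>} \<in> family_closure (maximal_sets F)"
    and clG: "\<And>\<alpha>. {\<alpha>} \<in> family_closure (maximal_sets G)"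
    and T: "comb_isometry F G T" and R: "comb_isometry G F R"
    and T_R: "\<And>y. y \<in> comb_space G \<Longrightarrow> T (R y) = y"
  obtains b where "{b. T (unit_vec b) \<alpha> \<noteq> 0} = {b}" "{\<alpha>. R (unit_vec \<alpha>) b \<noteq> 0} = {\<alpha>}"
proof -
  let ?S = "{b. T (unit_vec b) \<alpha> \<noteq> 0}"
  have S: "?S \<in> F" by (rule isometry_matrix_row(2)[OF F G(1) clG T])
  have fin: "finite ?S" using S F(1) by (simp add: family_on_def)
  have only: "\<alpha>' = \<alpha>" if b: "b \<in> ?S" and nz: "R (unit_vec \<alpha>') b \<noteq> 0" for b \<alpha>'
  proof (rule ccontr)
    assume "\<alpha>' \<noteq> \<alpha>"
    have e: "unit_vec \<alpha>' \<in> comb_space G" by (rule unit_vec_in_comb_space[OF G(1)])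
    have "0 = T (R (unit_vec \<alpha>')) \<alpha>"
      using T_R[OF e] \<open>\<alpha>' \<noteq> \<alpha>\<close> by (simp add: unit_vec_def)
    also have "\<dots> = (\<Sum>c\<in>?S. T (unit_vec c) \<alpha> * R (unit_vec \<alpha>') c)"
      by (rule isometry_coordinate_expansion[OF F G(1) clG T comb_isometryD(2)[OF R e]])
    also have "\<dots> = (\<Sum>c\<in>{b}. T (unit_vec c) \<alpha> * R (unit_vec \<alpha>') c)"
      using b nz fin isometry_column_disjoint[OF G F(1) clF R S]
      by (intro sum.mono_neutral_right) auto
    finally show False using b nz by simp
  qed
  have row_R: "R (unit_vec \<alpha>) b \<noteq> 0" if "b \<in> ?S" for b
    using isometry_matrix_row_nonempty[OF G F(1) clF R] only[OF that] by metis
  obtain b where b: "b \<in> ?S"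
    using isometry_matrix_row_nonempty[OF F G(1) clG T] by blast
  have "?S = {b}"
    using b row_R isometry_column_disjoint[OF G F(1) clF R S] by blast
  moreover have "{\<alpha>. R (unit_vec \<alpha>) b \<noteq> 0} = {\<alpha>}"
    using only[OF b] row_R[OF b] by blast
  ultimately show thesis by (rule that)
qed

theorem isometry_is_signed_permutation:
  fixes T :: "('k \<Rightarrow> 'a::{real_normed_field, real_inner}) \<Rightarrow> 'k \<Rightarrow> 'a"
  assumes F: "family_on F" "compact_family F" "hereditary F"
    and G: "family_on G" "compact_family G" "hereditary G"
    and clF: "\<And>\<alpha>. {\<alpha>} \<in> family_closure (maximal_sets F)"
    and clG: "\<And>\<alpha>. {\<alpha>} \<in> family_closure (maximal_sets G)"
    and T: "comb_isometry F G T"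
  shows "\<exists>\<pi> \<theta>. bij \<pi> \<and> (\<forall>\<alpha>. norm (\<theta> \<alpha>) = 1) \<and>
    (\<forall>\<alpha>. T (unit_vec \<alpha>) = (\<lambda>\<beta>. \<theta> \<alpha> * unit_vec (\<pi> \<alpha>) \<beta>))"
proof -
  obtain R where R: "comb_isometry G F R"
    "\<And>x. x \<in> comb_space F \<Longrightarrow> R (T x) = x" "\<And>y. y \<in> comb_space G \<Longrightarrow> T (R y) = y"
    using comb_isometry_inverse[OF F(1) T] by blast
  have "\<exists>b. {b. T (unit_vec b) \<alpha> \<noteq> 0} = {b} \<and> {\<alpha>. R (unit_vec \<alpha>) b \<noteq> 0} = {\<alpha>}" for \<alpha>
    by (rule isometry_row_singleton[OF F G clF clG T R(1,3), of \<alpha>], assumption, intro exI conjI)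
  then obtain \<sigma> where \<sigma>: "\<And>\<alpha>. {b. T (unit_vec b) \<alpha> \<noteq> 0} = {\<sigma> \<alpha>}"
    "\<And>\<alpha>. {\<alpha>'. R (unit_vec \<alpha>') (\<sigma> \<alpha>) \<noteq> 0} = {\<alpha>}"
    by metis
  have "\<exists>\<alpha>. {\<alpha>. R (unit_vec \<alpha>) b \<noteq> 0} = {\<alpha>} \<and> {b. T (unit_vec b) \<alpha> \<noteq> 0} = {b}" for b
    by (rule isometry_row_singleton[OF G F clG clF R(1) T R(2), of b], assumption, intro exI conjI)
  then obtain \<pi> where \<pi>: "\<And>b. {\<alpha>. R (unit_vec \<alpha>) b \<noteq> 0} = {\<pi> b}"
    "\<And>b. {b'. T (unit_vec b') (\<pi> b) \<noteq> 0} = {b}"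
    by metis
  have inv: "\<pi> (\<sigma> \<alpha>) = \<alpha>" "\<sigma> (\<pi> \<alpha>) = \<alpha>" for \<alpha>
    using \<sigma>(2)[of \<alpha>] \<pi>(1)[of "\<sigma> \<alpha>"] \<sigma>(1)[of "\<pi> \<alpha>"] \<pi>(2)[of \<alpha>] by simp_all
  then have "bij \<pi>" by (intro o_bij[of \<sigma> \<pi>]) auto
  have nz: "T (unit_vec \<alpha>) \<beta> \<noteq> 0 \<longleftrightarrow> \<beta> = \<pi> \<alpha>" for \<alpha> \<beta>
  proof -
    have "T (unit_vec \<alpha>) \<beta> \<noteq> 0 \<longleftrightarrow> \<alpha> = \<sigma> \<beta>" using \<sigma>(1)[of \<beta>] by blast
    then show ?thesis using inv by metis
  qed
  define \<theta> where "\<theta> \<alpha> = T (unit_vec \<alpha>) (\<pi> \<alpha>)" for \<alpha>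
  have "norm (\<theta> \<alpha>) = 1" for \<alpha>
    unfolding \<theta>_def using nz by (intro isometry_matrix_row(1)[OF F G(1) clG T]) simp
  moreover have "T (unit_vec \<alpha>) = (\<lambda>\<beta>. \<theta> \<alpha> * unit_vec (\<pi> \<alpha>) \<beta>)" for \<alpha>
    using nz by (auto simp: fun_eq_iff unit_vec_def \<theta>_def)
  ultimately show ?thesis using \<open>bij \<pi>\<close> by blast
qed

theorem theorem7:
  fixes F G :: "'k set set"
  assumes "infinite (UNIV :: 'k set)"
    and "family_on F" and "compact_family F" and "hereditary F"
    and "family_on G" and "compact_family G" and "hereditary G"
    and "\<forall>\<alpha>. {\<alpha>} \<in> family_closure (maximal_sets F) \<inter> family_closure (maximal_sets G)"
  shows "(\<forall>T :: ('k \<Rightarrow> real) \<Rightarrow> ('k \<Rightarrow> real). comb_isometry F G T \<longrightarrow>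
            (\<exists>\<pi> \<theta>. bij \<pi> \<and> (\<forall>\<alpha>. norm (\<theta> \<alpha>) = 1) \<and>
               (\<forall>\<alpha>. T (unit_vec \<alpha>) = (\<lambda>\<beta>. \<theta> \<alpha> * unit_vec (\<pi> \<alpha>) \<beta>)))) \<and>
         (\<forall>T :: ('k \<Rightarrow> complex) \<Rightarrow> ('k \<Rightarrow> complex). comb_isometry F G T \<longrightarrow>
            (\<exists>\<pi> \<theta>. bij \<pi> \<and> (\<forall>\<alpha>. norm (\<theta> \<alpha>) = 1) \<and>
               (\<forall>\<alpha>. T (unit_vec \<alpha>) = (\<lambda>\<beta>. \<theta> \<alpha> * unit_vec (\<pi> \<alpha>) \<beta>))))"
  using assms by (intro conjI allI impI isometry_is_signed_permutation[of F G]) auto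

end
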